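(* For every number of agents $n$ and every number of resources $m$, the Brick-Laying strategy $\mathrm{BL}$ is majorization minimax-optimal. That is, for every (possibly randomized) allocation strategy $\mathcal{A}'$ and every adversarial strategy $\mathcal{P}\in\mathcal{P}_{n,m}$, there exists an adversarial strategy $\mathcal{P}'\in\mathcal{P}_{n,m}$ such that, with probability $1$, $$\boldsymbol{\ell}(\mathrm{BL},\mathcal{P})\preceq \boldsymbol{\ell}(\mathcal{A}',\mathcal{P}')\qquad\text{and}\qquad \mathrm{OPT}(\mathrm{BL},\mathcal{P})\succeq \mathrm{OPT}(\mathcal{A}',\mathcal{P}').$$
   Context: **Notation.** $[n]=\{1,\dots,n\}$; for a vector $\mathbf{x}$ indexed by $[n]$ and $A\subseteq[n]$, $\mathbf{x}(A)=\sum_{i\in A}\mathbf{x}(i)$. **Discrete polymatroids.** A rank function is $r:2^{[n]}\to\mathbb{Z}_{\ge 0}$ that is normalized ($r(\emptyset)=0$), monotone ($r(A)\le r(B)$ for $A\subseteq B$) and submodular ($r(A)+r(B)\ge r(A\cap B)+r(A\cup B)$). It defines the discrete polymatroid $P=\{\mathbf{x}\in\mathbb{Z}_{\ge0}^n : \mathbf{x}(A)\le r(A)\ \forall A\subseteq[n]\}$, with $\mathrm{Rank}(P)=r([n])$ and $\mathrm{Bases}(P)=\{\mathbf{x}\in P:\mathbf{x}([n])=r([n])\}$. **Game.** On round $t=1,2,\dots$ the adversary presents a discrete polymatroid $P_t$ on $[n]$; the algorithm designer then irrevocably selects a basis $\mathbf{x}_t\in\mathrm{Bases}(P_t)$. The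 game ends after a finite number $h$ of rounds, when $\sum_{t=1}^h \mathrm{Rank}(P_t)=m$ exactly. An adversarial strategy $\mathcal{P}$ deterministically maps the history of play (all previous polymatroids and selected bases) to the next polymatroid; $\mathcal{P}_{n,m}$ is the set of adversarial strategies for $n$ agents and $m$ resources (against every designer strategy, the total rank presented is exactly $m$). An allocation strategy $\mathcal{A}$ maps, possibly at random, a history of play and the currently presented polymatroid to a basis of that polymatroid. The profile $(\mathcal{A},\mathcal{P})$ induces a (possibly random) sequence of polymatroids $(P_t)_{t\in[h]}$ and bases $(\mathbf{x}_t)_{t\in[h]}$; set $\boldsymbol{\ell}(\mathcal{A},\mathcal{P})=\sum_{t\in[h]}\mathbf{x}_t$ (the load vector) and $H(\mathcal{A},\mathcal{P})=\{\sum_{t\in[h]}\mathbf{z}_t:\mathbf{z}_t\in\mathrm{Bases}(P_t)\}$ (the feasible hindsight load vectors). **Majorization.** For $\mathbf{x},\mathbf{y}\in\mathbb{Z}_{\ge0}^n$ with $\mathbf{x}([n])=\mathbf{y}([n])$, write $\mathbf{x}\succeq\mathbf{y}$ (equivalently $\mathbf{y}\preceq\mathbf{x}$) when $\mathbf{x}^{\uparrow}([k])\le\mathbf{y}^{\uparrow}([k])$ for all $k\in[n]$, where $\mathbf{x}^\uparrow(i)$ is the $i$-th smallest entry of $\mathbf{x}$. **Hindsight optimum.** $\mathrm{OPT}(\mathcal{A},\mathcal{P})$ denotes a majorization-minimal element of $H(\mathcal{A},\mathcal{P})$, i.e. an element $\boldsymbol{\ell}^*\in H(\mathcal{A},\mathcal{P})$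 with $\boldsymbol{\ell}^*\preceq\boldsymbol{\ell}$ for all $\boldsymbol{\ell}\in H(\mathcal{A},\mathcal{P})$. Such an element always exists and is unique up to permutation of coordinates; it is random through the realized polymatroid sequence. **Brick-Laying.** $\mathrm{BL}$ is the deterministic strategy which, on round $t$ with current load $\boldsymbol{\ell}_{t-1}=\sum_{s<t}\mathbf{x}_s$, selects any $\mathbf{x}_t\in\mathrm{Bases}(P_t)$ with $\boldsymbol{\ell}_{t-1}+\mathbf{x}_t\preceq\boldsymbol{\ell}_{t-1}+\mathbf{x}$ for all $\mathbf{x}\in\mathrm{Bases}(P_t)$ (such a basis always exists; ties are broken by an arbitrary deterministic rule). *)

theory Defs
  imports "HOL-Probability.Probability"
begin

text \<open>
  The agents are the elements of a finite type \<open>'n\<close>, so the number of agents is \<open>CARD('n)\<close>.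
  A discrete polymatroid determines its rank function and vice versa; it is represented by the
  rank function, and \<open>vectors\<close> below recovers the set of integer points.
\<close>

typedef 'n polymatroid =
  "{r :: 'n set \<Rightarrow> nat. r {} = 0 \<and> (\<forall>A B. A \<subseteq> B \<longrightarrow> r A \<le> r B) \<and>
     (\<forall>A B. r A + r B \<ge> r (A \<inter> B) + r (A \<union> B))}"
  morphisms rank_fun Abs_polymatroid
  by (rule exI[of _ "\<lambda>_. 0"]) simp

definition vectors :: "'n::finite polymatroid \<Rightarrow> ('n \<Rightarrow> nat) set" where
  "vectors P = {x. \<forall>A. (\<Sum>i\<in>A. x i) \<le> rank_fun P A}"

definition Rank :: "'n::finite polymatroid \<Rightarrow> nat" where
  "Rank P = rank_fun P UNIV"

definition bases :: "'n::finite polymatroid \<Rightarrow> ('n \<Rightarrow> nat) set" where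
  "bases P = {x \<in> vectors P. (\<Sum>i\<in>UNIV. x i) = Rank P}"

definition ascending :: "('n::finite \<Rightarrow> nat) \<Rightarrow> nat list" where
  "ascending x = sorted_list_of_multiset (image_mset x (mset_set UNIV))"

definition majorizes :: "('n::finite \<Rightarrow> nat) \<Rightarrow> ('n \<Rightarrow> nat) \<Rightarrow> bool" (infix \<open>\<succeq>\<close> 50) where
  "x \<succeq> y \<longleftrightarrow> (\<Sum>i\<in>UNIV. x i) = (\<Sum>i\<in>UNIV. y i) \<and>
     (\<forall>k\<in>{1..CARD('n)}. sum_list (take k (ascending x)) \<le> sum_list (take k (ascending y)))"

abbreviation majorized_by :: "('n::finite \<Rightarrow> nat) \<Rightarrow> ('n \<Rightarrow> nat) \<Rightarrow> bool" (infix \<open>\<preceq>\<close> 50) where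
  "y \<preceq> x \<equiv> x \<succeq> y"

text \<open>A history lists the rounds in chronological order.\<close>

type_synonym 'n history = "('n polymatroid \<times> ('n \<Rightarrow> nat)) list"

type_synonym 'n adversary = "'n history \<Rightarrow> 'n polymatroid"

type_synonym 'n allocation = "'n history \<Rightarrow> 'n polymatroid \<Rightarrow> ('n \<Rightarrow> nat) pmf"

definition allocation_strategy :: "'n::finite allocation \<Rightarrow> bool" where
  "allocation_strategy A \<longleftrightarrow> (\<forall>h P. set_pmf (A h P) \<subseteq> bases P)"

definition deterministic ::
  "('n history \<Rightarrow> 'n polymatroid \<Rightarrow> ('n \<Rightarrow> nat)) \<Rightarrow> 'n allocation" where
  "deterministic B = (\<lambda>h P. return_pmf (B h P))"

definition presented :: "'n::finite history \<Rightarrow> nat" where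
  "presented h = (\<Sum>(P, x)\<leftarrow>h. Rank P)"

definition load :: "'n history \<Rightarrow> 'n \<Rightarrow> nat" where
  "load h i = (\<Sum>(P, x)\<leftarrow>h. x i)"

definition hindsight :: "'n::finite history \<Rightarrow> ('n \<Rightarrow> nat) set" where
  "hindsight h = {\<lambda>i. \<Sum>t<length h. z t i | z. \<forall>t<length h. z t \<in> bases (fst (h ! t))}"

definition OPT :: "'n::finite history \<Rightarrow> 'n \<Rightarrow> nat" where
  "OPT h = (SOME l. l \<in> hindsight h \<and> (\<forall>l'\<in>hindsight h. l \<preceq> l'))"

text \<open>
  \<open>play A P m t\<close> is the distribution of the history after \<open>t\<close> rounds, where a play stops (its
  history no longer grows) as soon as the total presented rank is \<open>m\<close>.
\<close>

fun play :: "'n::finite allocation \<Rightarrow> 'n adversary \<Rightarrow> nat \<Rightarrow> nat \<Rightarrow> 'n history pmf" where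
  "play A P m 0 = return_pmf []"
| "play A P m (Suc t) = bind_pmf (play A P m t) (\<lambda>h.
     if presented h = m then return_pmf h
     else map_pmf (\<lambda>x. h @ [(P h, x)]) (A h (P h)))"

definition ended_by :: "'n::finite allocation \<Rightarrow> 'n adversary \<Rightarrow> nat \<Rightarrow> nat \<Rightarrow> bool" where
  "ended_by A P m T \<longleftrightarrow> (\<forall>h\<in>set_pmf (play A P m T). presented h = m)"

text \<open>
  A polymatroid has finitely many bases and adversaries are deterministic, so by Koenig's lemma
  it is equivalent to ask that every individual play ends or, as here, that for each designer
  strategy there is a common bound on the number of rounds.
\<close>

definition adversaries :: "nat \<Rightarrow> 'n::finite adversary set" where
  "adversaries m = {P. \<forall>A. allocation_strategy A \<longrightarrow> (\<exists>T. ended_by A P m T)}"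

text \<open>The complete play; \<open>play A P m T\<close> is the same for all \<open>T\<close> with \<open>ended_by A P m T\<close>.\<close>

definition outcome :: "'n::finite allocation \<Rightarrow> 'n adversary \<Rightarrow> nat \<Rightarrow> 'n history pmf" where
  "outcome A P m = play A P m (LEAST T. ended_by A P m T)"

text \<open>Any tie-breaking rule is allowed: the predicate holds for every deterministic strategy that
  always selects a least majorized resulting load.\<close>

definition brick_laying ::
  "('n::finite history \<Rightarrow> 'n polymatroid \<Rightarrow> ('n \<Rightarrow> nat)) \<Rightarrow> bool" where
  "brick_laying B \<longleftrightarrow> (\<forall>h P. B h P \<in> bases P \<and>
     (\<forall>x\<in>bases P. (\<lambda>i. load h i + B h P i) \<preceq> (\<lambda>i. load h i + x i)))"

end

theory Submission
  imports Defs
begin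

text \<open>
  Write \<open>M x c = (\<Sum>i. min (x i) c)\<close>; then \<open>x \<succeq> y\<close> means equal totals and \<open>M x c \<le> M y c\<close> for
  all caps \<open>c\<close>. Let \<open>l\<close> be the final load of Brick-Laying and \<open>N c\<close> the number of agents with
  \<open>l i \<ge> c\<close>, so that \<open>M l c = N 1 + \<dots> + N c\<close>. The adversary \<open>P'\<close> offers \<open>N (c + 1)\<close>
  bricks, to be placed freely on a set \<open>S c\<close> of \<open>N c\<close> agents, and then shrinks \<open>S c\<close> to its
  \<open>N (c + 1)\<close> most loaded members. As loads are integers, the members of \<open>S c\<close> keep
  carrying at least \<open>c\<close> bricks on average; the agents outside are never served again, so any load \<open>l'\<close> has \<open>M l' c \<le> M l c\<close>.

  In hindsight, a load \<open>y\<close> is dominated by a feasible one for \<open>P'\<close> as soon as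
  \<open>y {i. l i < c} \<le> M l c\<close> for all \<open>c\<close>. Feasible loads of the original game satisfy this:
  in one round, if \<open>z {i. l i < c}\<close> exceeded the gain in \<open>M l c\<close>, then an augmentation would give
  a basis with larger gain than the one chosen by Brick-Laying.
\<close>

section \<open>Majorization and capped sums\<close>

definition capped_sum :: "('n::finite \<Rightarrow> nat) \<Rightarrow> nat \<Rightarrow> nat" where
  "capped_sum x c = (\<Sum>i\<in>UNIV. min (x i) c)"

section \<open>Capped sums of lists and partial sums of sorted entries\<close>

lemma sum_list_min_le:
  fixes xs :: "nat list"
  assumes "k \<le> length xs"
  shows "(\<Sum>a\<leftarrow>xs. min a c) \<le> sum_list (take k xs) + c * (length xs - k)"
proof -
  have "(\<Sum>a\<leftarrow>xs. min a c) = (\<Sum>a\<leftarrow>take k xs. min a c) + (\<Sum>a\<leftarrow>drop k xs. min a c)"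
    by (metis append_take_drop_id map_append sum_list_append)
  moreover have "(\<Sum>a\<leftarrow>take k xs. min a c) \<le> (\<Sum>a\<leftarrow>take k xs. a)"
    by (rule sum_list_mono) simp
  moreover have "(\<Sum>a\<leftarrow>drop k xs. min a c) \<le> (\<Sum>a\<leftarrow>drop k xs. c)"
    by (rule sum_list_mono) simp
  ultimately show ?thesis
    by (simp add: sum_list_triv mult.commute)
qed

lemma sum_list_min_eq:
  fixes xs :: "nat list"
  assumes "\<forall>a\<in>set (take k xs). a \<le> c" and "\<forall>a\<in>set (drop k xs). c \<le> a"
  shows "(\<Sum>a\<leftarrow>xs. min a c) = sum_list (take k xs) + c * (length xs - k)"
proof -
  have "(\<Sum>a\<leftarrow>xs. min a c) = (\<Sum>a\<leftarrow>take k xs. min a c) + (\<Sum>a\<leftarrow>drop k xs. min a c)"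
    by (metis append_take_drop_id map_append sum_list_append)
  moreover have "map (\<lambda>a. min a c) (take k xs) = take k xs"
    using assms(1) by (intro map_idI) simp
  moreover have "map (\<lambda>a. min a c) (drop k xs) = map (\<lambda>a. c) (drop k xs)"
    using assms(2) by simp
  ultimately show ?thesis
    by (simp add: sum_list_triv mult.commute del: map_eq_conv)
qed

lemma mset_ascending: "mset (ascending x) = image_mset x (mset_set UNIV)"
  by (simp add: ascending_def)

lemma sorted_ascending: "sorted (ascending x)"
  by (simp add: ascending_def)

lemma length_ascending: "length (ascending (x :: 'n::finite \<Rightarrow> nat)) = CARD('n)"
  by (metis mset_ascending size_image_mset size_mset size_mset_set)

lemma sum_list_map_ascending:
  fixes f :: "nat \<Rightarrow> nat"
  shows "(\<Sum>a\<leftarrow>ascending x. f a) = (\<Sum>i\<in>UNIV. f (x i))"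
proof -
  have "(\<Sum>a\<leftarrow>ascending x. f a) = sum_mset (mset (map f (ascending x)))"
    by (simp only: sum_mset_sum_list)
  also have "\<dots> = sum_mset (image_mset (\<lambda>i. f (x i)) (mset_set UNIV))"
    by (simp add: mset_ascending image_mset.compositionality comp_def)
  finally show ?thesis
    by (simp add: sum_unfold_sum_mset)
qed

lemma capped_sum_ascending: "capped_sum x c = (\<Sum>a\<leftarrow>ascending x. min a c)"
  by (simp add: capped_sum_def sum_list_map_ascending)

text \<open>Cutting a list after k entries bounds its capped sum by the first k entries plus c for
  every other one, with equality if c separates the two pieces. Each direction picks the cut that is
  exact where equality is needed: given c, let k count the entries of \<open>y\<close> below c;
  given k, let c be the entry of \<open>x\<close> at index k.\<close>

lemma majorizes_iff_capped_sum:
  fixes x y :: "'n::finite \<Rightarrow> nat"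
  shows "x \<succeq> y \<longleftrightarrow> (\<Sum>i\<in>UNIV. x i) = (\<Sum>i\<in>UNIV. y i) \<and> (\<forall>c. capped_sum x c \<le> capped_sum y c)"
    (is "?L \<longleftrightarrow> ?S \<and> ?R")
proof (intro iffI conjI allI)
  assume L: ?L
  then show ?S by (simp add: majorizes_def)
  fix c
  define k where "k = length (takeWhile (\<lambda>a. a < c) (ascending y))"
  have k: "k \<le> CARD('n)"
    by (metis k_def length_ascending length_takeWhile_le)
  have split: "take k (ascending y) = takeWhile (\<lambda>a. a < c) (ascending y)"
    "drop k (ascending y) = dropWhile (\<lambda>a. a < c) (ascending y)"
    by (simp_all add: k_def takeWhile_eq_take[symmetric] dropWhile_eq_drop[symmetric])
  have "\<forall>a\<in>set (dropWhile (\<lambda>a. a < c) (ascending y)). c \<le> a"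
  proof (cases "dropWhile (\<lambda>a. a < c) (ascending y)")
    case (Cons b bs)
    have "\<not> b < c" using Cons by (metis hd_dropWhile list.distinct(1) list.sel(1))
    moreover have "sorted (b # bs)"
      by (metis Cons sorted_ascending sorted_dropWhile)
    ultimately show ?thesis using Cons by auto
  next
    case Nil
    then show ?thesis by (metis empty_iff list.set(1))
  qed
  then have "capped_sum y c = sum_list (take k (ascending y)) + c * (CARD('n) - k)"
    unfolding capped_sum_ascending length_ascending[of y, symmetric]
    by (intro sum_list_min_eq) (auto simp: split dest: set_takeWhileD)
  moreover have "capped_sum x c \<le> sum_list (take k (ascending x)) + c * (CARD('n) - k)"
    unfolding capped_sum_ascending length_ascending[of x, symmetric]
    by (intro sum_list_min_le) (simp add: length_ascending k)
  moreover have "sum_list (take k (ascending x)) \<le> sum_list (take k (ascending y))"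
    using L k by (cases "k = 0") (auto simp: majorizes_def)
  ultimately show "capped_sum x c \<le> capped_sum y c" by linarith
next
  assume R: "?S \<and> ?R"
  show ?L
    unfolding majorizes_def
  proof (intro conjI ballI)
    show ?S using R by simp
    fix k assume k: "k \<in> {1..CARD('n)}"
    show "sum_list (take k (ascending x)) \<le> sum_list (take k (ascending y))"
    \<comment> \<open>The cap \<open>ascending x ! k\<close> exists only for
      \<open>k < CARD('n)\<close>; the last partial sum is the total.\<close>
    proof (cases "k = CARD('n)")
      case True
      then show ?thesis
        using R sum_list_map_ascending[of "\<lambda>a. a" x] sum_list_map_ascending[of "\<lambda>a. a" y]
        by (simp add: length_ascending)
    next
      case False
      with k have lt: "k < length (ascending x)" by (simp add: length_ascending)
      define c where "c = ascending x ! k"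
      have "capped_sum x c = sum_list (take k (ascending x)) + c * (CARD('n) - k)"
        unfolding capped_sum_ascending length_ascending[of x, symmetric]
      proof (rule sum_list_min_eq)
        show "\<forall>a\<in>set (take k (ascending x)). a \<le> c"
          using lt sorted_nth_mono[OF sorted_ascending, of _ k x]
          by (auto simp: in_set_conv_nth c_def)
        show "\<forall>a\<in>set (drop k (ascending x)). c \<le> a"
          using lt sorted_nth_mono[OF sorted_ascending, of k _ x]
          by (auto simp: in_set_conv_nth c_def)
      qed
      moreover have "capped_sum y c \<le> sum_list (take k (ascending y)) + c * (CARD('n) - k)"
        unfolding capped_sum_ascending length_ascending[of y, symmetric]
        using k by (intro sum_list_min_le) (simp add: length_ascending)
      moreover have "capped_sum x c \<le> capped_sum y c" using R by blast
      ultimately show ?thesis by linarith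
    qed
  qed
qed

lemma capped_sum_mono: "(\<And>i. x i \<le> y i) \<Longrightarrow> capped_sum x c \<le> capped_sum y c"
  unfolding capped_sum_def by (intro sum_mono min.mono) auto

lemma capped_sum_mono_cap: "c \<le> d \<Longrightarrow> capped_sum x c \<le> capped_sum x d"
  unfolding capped_sum_def by (intro sum_mono) auto

lemma capped_sum_le_sum: "capped_sum x c \<le> (\<Sum>i\<in>UNIV. x i)"
  unfolding capped_sum_def by (intro sum_mono) auto

lemma capped_sum_eq_sum: "(\<And>i. x i \<le> c) \<Longrightarrow> capped_sum x c = (\<Sum>i\<in>UNIV. x i)"
  unfolding capped_sum_def by (intro sum.cong) auto

lemma sum_UNIV_split: "(\<Sum>i\<in>UNIV. f i) = sum f A + sum f (- A)" for f :: "'n::finite \<Rightarrow> nat"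
  by (metis Compl_partition Compl_disjoint finite sum.union_disjoint)

lemma capped_sum_le_cut: "capped_sum x c \<le> sum x A + c * card (- A)"
proof -
  have "sum (\<lambda>i. min (x i) c) A \<le> sum x A" by (intro sum_mono) auto
  moreover have "sum (\<lambda>i. min (x i) c) (- A) \<le> (\<Sum>i\<in>- A. c)" by (intro sum_mono) auto
  ultimately show ?thesis
    unfolding capped_sum_def sum_UNIV_split[of _ A] by (simp add: mult.commute)
qed

lemma capped_sum_0: "capped_sum x 0 = 0"
  by (simp add: capped_sum_def)

lemma capped_sum_Suc: "capped_sum x (Suc c) = capped_sum x c + card {i. Suc c \<le> x i}"
proof -
  have "capped_sum x (Suc c) = (\<Sum>i\<in>UNIV. min (x i) c + (if Suc c \<le> x i then 1 else 0))"
    unfolding capped_sum_def by (intro sum.cong) auto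
  then show ?thesis
    by (simp add: sum.distrib capped_sum_def sum.If_cases)
qed


section \<open>Integer points of a rank function\<close>

definition rank_function :: "('n set \<Rightarrow> nat) \<Rightarrow> bool" where
  "rank_function r \<longleftrightarrow> r {} = 0 \<and> (\<forall>A B. A \<subseteq> B \<longrightarrow> r A \<le> r B) \<and>
     (\<forall>A B. r A + r B \<ge> r (A \<inter> B) + r (A \<union> B))"

definition points :: "('n set \<Rightarrow> nat) \<Rightarrow> ('n::finite \<Rightarrow> nat) set" where
  "points r = {x. \<forall>A. sum x A \<le> r A}"

lemma sum_increment:
  fixes x :: "'n::finite \<Rightarrow> nat"
  shows "sum (x(i := Suc (x i))) A = sum x A + (if i \<in> A then 1 else 0)"
proof -
  have "sum (x(i := Suc (x i))) A = (\<Sum>j\<in>A. x j + (if i = j then 1 else 0))"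
    by (intro sum.cong) auto
  then show ?thesis by (simp add: sum.distrib)
qed

lemma sum_decrement:
  fixes x :: "'n::finite \<Rightarrow> nat"
  assumes "0 < x i"
  shows "sum x A = sum (x(i := x i - 1)) A + (if i \<in> A then 1 else 0)"
  using sum_increment[of "x(i := x i - 1)" i A] assms by simp

lemma rank_function_rank_fun: "rank_function (rank_fun P)"
  using rank_fun[of P] by (simp add: rank_function_def)

lemma vectors_eq_points: "vectors P = points (rank_fun P)"
  by (simp add: vectors_def points_def)

lemma points_downward: "v \<in> points r \<Longrightarrow> (\<And>i. w i \<le> v i) \<Longrightarrow> w \<in> points r"
  unfolding points_def by (auto intro: order_trans[OF sum_mono])

text \<open>A coordinate that cannot grow lies in a tight set, and submodularity makes unions of
  tight sets tight.\<close>

lemma tight_cover: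
  assumes r: "rank_function r" and x: "x \<in> points r"
    and max: "\<And>i. i \<in> I \<Longrightarrow> x(i := Suc (x i)) \<notin> points r"
  obtains D where "I \<subseteq> D" "sum x D = r D"
proof -
  have "finite I" by simp
  then have "\<exists>D. I \<subseteq> D \<and> sum x D = r D" using max
  proof (induction I rule: finite_induct)
    case empty
    have "sum x {} = r {}" using r by (simp add: rank_function_def)
    then show ?case by blast
  next
    case (insert i I)
    then obtain D where D: "I \<subseteq> D" "sum x D = r D" by blast
    obtain E where E: "sum (x(i := Suc (x i))) E > r E"
      using insert.prems[of i] by (auto simp: points_def not_le)
    have xle: "sum x A \<le> r A" for A using x by (simp add: points_def)
    have iE: "i \<in> E" and tE: "sum x E = r E"
      using E xle[of E] unfolding sum_increment by (auto split: if_splits)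
    have "sum x (D \<union> E) + sum x (D \<inter> E) = r D + r E"
      using D tE by (simp add: sum.union_inter)
    moreover have "r (D \<inter> E) + r (D \<union> E) \<le> r D + r E"
      using r by (simp add: rank_function_def)
    ultimately have "sum x (D \<union> E) = r (D \<union> E)"
      using xle[of "D \<union> E"] xle[of "D \<inter> E"] by linarith
    with D iE show ?case by (intro exI[of _ "D \<union> E"]) auto
  qed
  then show thesis using that by blast
qed

text \<open>Exchange property. Otherwise a tight set \<open>D\<close> covers every i with
  \<open>v i < u i\<close>: on \<open>D\<close> the sum of \<open>u\<close> is at most
  \<open>r D\<close>, which is the sum of \<open>v\<close>, and off \<open>D\<close> it is pointwise
  at most \<open>v\<close>, so \<open>u\<close> cannot have the larger total.\<close>

lemma augment:
  assumes r: "rank_function r" and v: "v \<in> points r" and u: "u \<in> points r"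
    and less: "sum v UNIV < sum u UNIV"
  obtains i where "v i < u i" "v(i := Suc (v i)) \<in> points r"
proof (rule ccontr)
  assume "\<not> thesis"
  then have no: "\<And>i. i \<in> {i. v i < u i} \<Longrightarrow> v(i := Suc (v i)) \<notin> points r" using that by auto
  obtain D where D: "{i. v i < u i} \<subseteq> D" "sum v D = r D"
    by (rule tight_cover[OF r v no])
  have "sum u D \<le> sum v D" using u D by (simp add: points_def)
  moreover have "sum u (- D) \<le> sum v (- D)"
    using D by (intro sum_mono) (use leI in auto)
  ultimately show False
    using less sum_UNIV_split[of u D] sum_UNIV_split[of v D] by simp
qed

lemma extend:
  assumes r: "rank_function r" and "v \<in> points r" and u: "u \<in> points r"
  obtains w where "w \<in> points r" "\<And>i. v i \<le> w i" "\<And>i. w i \<le> max (u i) (v i)"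
    "sum u UNIV \<le> sum w UNIV"
proof -
  have "\<exists>w\<in>points r. (\<forall>i. v i \<le> w i \<and> w i \<le> max (u i) (v i)) \<and> sum u UNIV \<le> sum w UNIV"
    using assms(2)
  proof (induction "sum u UNIV - sum v UNIV" arbitrary: v rule: less_induct)
    case less
    show ?case
    proof (cases "sum u UNIV \<le> sum v UNIV")
      case True
      then show ?thesis using less.prems by auto
    next
      case False
      then have "sum v UNIV < sum u UNIV" by simp
      then obtain i where i: "v i < u i" "v(i := Suc (v i)) \<in> points r"
        by (rule augment[OF r less.prems u])
      let ?v = "v(i := Suc (v i))"
      have "sum ?v UNIV = Suc (sum v UNIV)" unfolding sum_increment by simp
      with False have "sum u UNIV - sum ?v UNIV < sum u UNIV - sum v UNIV" by simp
      from less.hyps[OF this i(2)] obtain w where w: "w \<in> points r"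
        "\<And>j. ?v j \<le> w j \<and> w j \<le> max (u j) (?v j)" "sum u UNIV \<le> sum w UNIV" by blast
      have "v j \<le> w j \<and> w j \<le> max (u j) (v j)" for j
        using w(2)[of j] i(1) by (cases "j = i") auto
      with w show ?thesis by blast
    qed
  qed
  then show thesis using that by blast
qed

section \<open>Maximal points in boxes and majorization-least bases\<close>

lemma exists_max_in_box:
  assumes r: "rank_function r"
  obtains u where "u \<in> points r" "\<And>i. u i \<le> c"
    "\<And>z. z \<in> points r \<Longrightarrow> (\<And>i. z i \<le> c) \<Longrightarrow> sum z UNIV \<le> sum u UNIV"
proof -
  let ?P = "\<lambda>u. u \<in> points r \<and> (\<forall>i. u i \<le> c)"
  have "?P (\<lambda>_. 0)" by (simp add: points_def)
  moreover have "\<forall>y. ?P y \<longrightarrow> sum y UNIV < Suc (r UNIV)" by (simp add: points_def less_Suc_eq_le)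
  ultimately have "\<exists>u. ?P u \<and> (\<forall>z. ?P z \<longrightarrow> sum z UNIV \<le> sum u UNIV)"
    by (rule ex_has_greatest_nat)
  then show thesis using that by blast
qed

text \<open>The set \<open>D\<close> certifies that \<open>v\<close> has maximal total in the box,
  since no point of the box exceeds \<open>r D + c * card (- D)\<close>. In a maximal
  \<open>v\<close> the coordinates below c cannot grow, so a tight \<open>D\<close> covers them, and
  outside \<open>D\<close> every coordinate equals c.\<close>

lemma min_max_in_box:
  assumes r: "rank_function r"
  obtains v D where "v \<in> points r" "\<And>i. v i \<le> c" "r D + c * card (- D) = sum v UNIV"
proof -
  obtain v where v: "v \<in> points r" "\<And>i. v i \<le> c"
    and max: "\<And>z. z \<in> points r \<Longrightarrow> (\<And>i. z i \<le> c) \<Longrightarrow> sum z UNIV \<le> sum v UNIV"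
    using exists_max_in_box[OF r] by metis
  have "v(i := Suc (v i)) \<notin> points r" if "i \<in> {i. v i < c}" for i
  proof
    assume "v(i := Suc (v i)) \<in> points r"
    then have "sum (v(i := Suc (v i))) UNIV \<le> sum v UNIV"
      using that v(2) by (intro max) auto
    then show False unfolding sum_increment by simp
  qed
  then obtain D where D: "{i. v i < c} \<subseteq> D" "sum v D = r D"
    using tight_cover[OF r v(1)] by metis
  have "sum v (- D) = (\<Sum>i\<in>- D. c)"
    using D v(2) by (intro sum.cong) (auto simp: subset_iff le_less)
  then have "r D + c * card (- D) = sum v UNIV"
    using D sum_UNIV_split[of v D] by (simp add: mult.commute)
  with v that show thesis by blast
qed

lemma rank_le: "rank_function r \<Longrightarrow> x \<in> points r \<Longrightarrow> x i \<le> r UNIV"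
proof -
  assume "rank_function r" "x \<in> points r"
  then have "sum x {i} \<le> r {i}" "r {i} \<le> r UNIV"
    by (auto simp: points_def rank_function_def simp del: sum.insert)
  then show ?thesis by simp
qed

lemma exists_capped_sum_max:
  assumes r: "rank_function r"
  obtains b where "b \<in> points r" "sum b UNIV = r UNIV"
    "\<And>z c. z \<in> points r \<Longrightarrow> capped_sum z c \<le> capped_sum b c"
proof -
  \<comment> \<open>Maximal points of growing boxes can be chosen increasing, so one point is optimal for all caps.\<close>
  have "\<exists>b\<in>points r. (\<forall>i. b i \<le> K) \<and> (\<forall>c\<le>K. \<forall>z\<in>points r. capped_sum z c \<le> capped_sum b c)" for K
  proof (induction K)
    case 0
    show ?case by (intro bexI[of _ "\<lambda>_. 0"]) (auto simp: points_def capped_sum_0)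
  next
    case (Suc K)
    then obtain b where b: "b \<in> points r" "\<And>i. b i \<le> K"
      "\<And>c z. c \<le> K \<Longrightarrow> z \<in> points r \<Longrightarrow> capped_sum z c \<le> capped_sum b c" by blast
    obtain u where u: "u \<in> points r" "\<And>i. u i \<le> Suc K"
      and max: "\<And>z. z \<in> points r \<Longrightarrow> (\<And>i. z i \<le> Suc K) \<Longrightarrow> sum z UNIV \<le> sum u UNIV"
      using exists_max_in_box[OF r] by metis
    obtain w where w: "w \<in> points r" "\<And>i. b i \<le> w i" "\<And>i. w i \<le> max (u i) (b i)"
      "sum u UNIV \<le> sum w UNIV"
      using extend[OF r b(1) u(1)] by metis
    have wK: "w i \<le> Suc K" for i using w(3)[of i] u(2)[of i] b(2)[of i] by simp
    have "capped_sum z c \<le> capped_sum w c" if c: "c \<le> Suc K" and z: "z \<in> points r" for c z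
    proof (cases "c = Suc K")
      case True
      have "(\<lambda>i. min (z i) c) \<in> points r" using z by (rule points_downward) simp
      then have "sum (\<lambda>i. min (z i) c) UNIV \<le> sum u UNIV" using True by (intro max) auto
      also have "\<dots> \<le> capped_sum w c"
        using w(4) wK True by (simp add: capped_sum_eq_sum)
      finally show ?thesis by (simp add: capped_sum_def)
    next
      case False
      then show ?thesis
        using b(3)[of c z] c z capped_sum_mono[of b w c] w(2) by fastforce
    qed
    with w wK show ?case by blast
  qed
  \<comment> \<open>No point has an entry above \<open>r UNIV\<close>, so at this cap the capped
    sums are plain sums.\<close>
  from this[of "r UNIV"] obtain b where b: "b \<in> points r" "\<And>i. b i \<le> r UNIV"
    "\<And>c z. c \<le> r UNIV \<Longrightarrow> z \<in> points r \<Longrightarrow> capped_sum z c \<le> capped_sum b c" by blast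
  have max: "sum z UNIV \<le> sum b UNIV" if z: "z \<in> points r" for z
    using b(3)[OF order_refl z] b(2) rank_le[OF r z] by (simp add: capped_sum_eq_sum)
  \<comment> \<open>As \<open>b\<close> has the largest total, no coordinate can grow; the tight set
    covering all of them is \<open>UNIV\<close>, so \<open>b\<close> attains the full rank.\<close>
  have "b(i := Suc (b i)) \<notin> points r" for i
    using max[of "b(i := Suc (b i))"] unfolding sum_increment by auto
  then obtain D where "UNIV \<subseteq> D" "sum b D = r D"
    using tight_cover[OF r b(1), of UNIV] by metis
  then have "sum b UNIV = r UNIV" by (metis top.extremum_unique)
  moreover have "capped_sum z c \<le> capped_sum b c" if z: "z \<in> points r" for z c
  proof (cases "c \<le> r UNIV")
    case False
    then have "b i \<le> c" for i using b(2)[of i] by simp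
    then have "capped_sum b c = sum b UNIV" by (rule capped_sum_eq_sum)
    then show ?thesis using max[OF z] capped_sum_le_sum[of z c] by simp
  qed (use b(3) z in blast)
  ultimately show thesis using that b(1) by blast
qed


section \<open>Sums of polymatroids\<close>

lemma rank_function_add:
  assumes "rank_function r" "rank_function s"
  shows "rank_function (\<lambda>A. r A + s A)"
  unfolding rank_function_def
proof (intro conjI allI impI)
  show "r {} + s {} = 0" using assms by (simp add: rank_function_def)
  fix A B
  show "r A + s A \<le> r B + s B" if "A \<subseteq> B"
    using assms that by (simp add: rank_function_def add_mono)
  have "r (A \<inter> B) + r (A \<union> B) \<le> r A + r B" "s (A \<inter> B) + s (A \<union> B) \<le> s A + s B"
    using assms by (simp_all add: rank_function_def)
  then show "r (A \<inter> B) + s (A \<inter> B) + (r (A \<union> B) + s (A \<union> B)) \<le> r A + s A + (r B + s B)"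
    by linarith
qed

text \<open>Rank function of the vectors that stay in \<open>points r\<close> after one more unit at
  i: the set A is bounded by \<open>r A\<close> and, through \<open>insert i A\<close>, by what is
  left there once the unit is laid.\<close>

definition contract :: "'n \<Rightarrow> ('n set \<Rightarrow> nat) \<Rightarrow> 'n set \<Rightarrow> nat" where
  "contract i r A = min (r A) (r (insert i A) - 1)"

lemma rank_function_contract:
  assumes r: "rank_function r" and i: "0 < r {i}"
  shows "rank_function (contract i r)"
proof -
  have mono: "A \<subseteq> B \<Longrightarrow> r A \<le> r B" for A B using r by (simp add: rank_function_def)
  have sub: "r (A \<inter> B) + r (A \<union> B) \<le> r A + r B" for A B
    using r by (simp add: rank_function_def)
  have pos: "0 < r (insert i A)" for A
    using mono[of "{i}" "insert i A"] i by simp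
  \<comment> \<open>Cases by which term attains the minimum at A and at B; each is submodularity of
    \<open>r\<close> with i inserted into the sets whose second term is attained. Positivity makes
    the natural-number subtractions exact.\<close>
  have "contract i r (A \<inter> B) + contract i r (A \<union> B) \<le> contract i r A + contract i r B" for A B
  proof -
    have "r (insert i (A \<inter> B)) + r (insert i (A \<union> B)) \<le> r (insert i A) + r (insert i B)"
      using sub[of "insert i A" "insert i B"]
      by (simp only: insert_inter_insert Un_insert_left Un_insert_right insert_absorb2)
    moreover have "r (A \<inter> B) + r (insert i (A \<union> B)) \<le> r A + r (insert i B)"
      using sub[of A "insert i B"] mono[of "A \<inter> B" "A \<inter> insert i B"]
      by (simp only: Un_insert_right) (meson Int_mono add_le_mono1 order_refl order_trans subset_insertI)
    moreover have "r (A \<inter> B) + r (insert i (A \<union> B)) \<le> r (insert i A) + r B"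
      using sub[of "insert i A" B] mono[of "A \<inter> B" "insert i A \<inter> B"]
      by (simp only: Un_insert_left) (meson Int_mono add_le_mono1 order_refl order_trans subset_insertI)
    ultimately show ?thesis
      using sub[of A B] pos[of A] pos[of B] pos[of "A \<inter> B"] pos[of "A \<union> B"]
      unfolding contract_def by linarith
  qed
  moreover have "contract i r A \<le> contract i r B" if "A \<subseteq> B" for A B
    unfolding contract_def using that mono[of A B] mono[of "insert i A" "insert i B"]
    by (intro min.mono diff_le_mono) auto
  moreover have "contract i r {} = 0" using r by (simp add: contract_def rank_function_def)
  ultimately show ?thesis by (simp add: rank_function_def)
qed

lemma points_contract:
  assumes r: "rank_function r" and i: "0 < r {i}" and y: "y \<in> points (contract i r)"
  shows "y(i := Suc (y i)) \<in> points r"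
  unfolding points_def
proof (intro CollectI allI)
  fix A
  have le: "sum y A \<le> contract i r A" using y by (simp add: points_def)
  show "sum (y(i := Suc (y i))) A \<le> r A"
  proof (cases "i \<in> A")
    case True
    then have "r {i} \<le> r A" using r by (simp add: rank_function_def)
    moreover have "sum y A \<le> r A - 1"
      using le True by (simp add: contract_def insert_absorb)
    ultimately show ?thesis using i True unfolding sum_increment by simp
  next
    case False
    then show ?thesis using le unfolding sum_increment by (simp add: contract_def)
  qed
qed

lemma contract_fails:
  assumes r: "rank_function r" and x: "x \<in> points (\<lambda>A. r A + s A)" and xi: "0 < x i"
    and fail: "r {i} = 0 \<or> x(i := x i - 1) \<notin> points (\<lambda>A. contract i r A + s A)"
    and s: "s {} = 0"
  obtains A where "i \<notin> A" "r (insert i A) + s A \<le> sum x A"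
proof (cases "r {i} = 0")
  case True
  then show thesis using that[of "{}"] s by simp
next
  case False
  with fail obtain A where A: "contract i r A + s A < sum (x(i := x i - 1)) A"
    by (auto simp: points_def not_le)
  have xA: "sum x A \<le> r A + s A" using x by (simp add: points_def)
  have iA: "i \<notin> A"
  proof
    assume iA: "i \<in> A"
    have "sum x A = sum (x(i := x i - 1)) A + 1"
      using sum_decrement[of x i A] xi iA by simp
    moreover have "contract i r A = r A - 1" using iA by (simp add: contract_def insert_absorb)
    ultimately show False using A xA by linarith
  qed
  then have less: "contract i r A + s A < sum x A"
    using A sum_decrement[of x i A] xi by simp
  then have "contract i r A \<noteq> r A" using xA by linarith
  then have "contract i r A = r (insert i A) - 1" by (simp add: contract_def min_def split: if_splits)
  with less have "r (insert i A) + s A \<le> sum x A" by linarith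
  with iA that show thesis by blast
qed

text \<open>Induction on the total: remove one unit of \<open>x\<close>, charge it to
  \<open>r\<close> or to \<open>s\<close> by contracting that function, and put it back into the
  part obtained.\<close>

lemma points_add_decompose:
  assumes "rank_function r" "rank_function s" "x \<in> points (\<lambda>A. r A + s A)"
  shows "\<exists>y\<in>points r. \<exists>z\<in>points s. x = (\<lambda>i. y i + z i)"
  using assms
proof (induction "sum x UNIV" arbitrary: x r s)
  case 0
  then have "x = (\<lambda>_. 0)" by auto
  then show ?case by (intro bexI[of _ "\<lambda>_. 0"]) (auto simp: points_def)
next
  case (Suc n)
  note r = \<open>rank_function r\<close> and s = \<open>rank_function s\<close>
  have "\<exists>i. 0 < x i"
  proof (rule ccontr)
    assume "\<nexists>i. 0 < x i"
    then have "sum x UNIV = 0" by simp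
    with Suc.hyps(2) show False by simp
  qed
  then obtain i where i: "0 < x i" ..
  let ?x = "x(i := x i - 1)"
  have n: "n = sum ?x UNIV"
    using Suc.hyps(2) sum_decrement[of x i UNIV] i by simp
  have IH: "\<exists>y\<in>points r. \<exists>z\<in>points s. x = (\<lambda>i. y i + z i)"
    if r: "rank_function r" and s: "rank_function s"
      and pos: "r {i} > 0" and mem: "?x \<in> points (\<lambda>A. contract i r A + s A)" for r s
  proof -
    from Suc.hyps(1)[OF n rank_function_contract[OF r pos] s mem]
    obtain y z where y: "y \<in> points (contract i r)" and z: "z \<in> points s"
      and eq: "?x = (\<lambda>j. y j + z j)" by blast
    have "x = (\<lambda>j. (y(i := Suc (y i))) j + z j)"
    proof
      fix j
      show "x j = (y(i := Suc (y i))) j + z j"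
        using fun_cong[OF eq, of j] i by (cases "j = i") auto
    qed
    with points_contract[OF r pos y] z show ?thesis by blast
  qed
  show ?case
  proof (cases "r {i} > 0 \<and> ?x \<in> points (\<lambda>A. contract i r A + s A)")
    case True
    then show ?thesis using IH[OF r s] by blast
  next
    case nr: False
    show ?thesis
    proof (cases "s {i} > 0 \<and> ?x \<in> points (\<lambda>A. contract i s A + r A)")
      case True
      then obtain y z where "y \<in> points s" "z \<in> points r" "x = (\<lambda>i. y i + z i)"
        using IH[OF s r] by blast
      then show ?thesis by (intro bexI[of _ z] bexI[of _ y]) (auto simp: add.commute)
    next
      case ns: False
      have x: "x \<in> points (\<lambda>A. r A + s A)" by (rule Suc.prems)
      then have x': "x \<in> points (\<lambda>A. s A + r A)" by (simp add: add.commute)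
      obtain A where A: "i \<notin> A" "r (insert i A) + s A \<le> sum x A"
        by (rule contract_fails[OF r x i]) (use nr s in \<open>auto simp: rank_function_def\<close>)
      obtain B where B: "i \<notin> B" "s (insert i B) + r B \<le> sum x B"
        by (rule contract_fails[OF s x' i]) (use ns r in \<open>auto simp: rank_function_def\<close>)
      \<comment> \<open>If neither function can take the unit, submodularity combines both witnesses
        into \<open>x i + sum x (A \<union> B) + sum x (A \<inter> B) \<le> sum x A + sum x
        B\<close>, which contradicts \<open>0 < x i\<close>.\<close>
      have "r (A \<inter> B) + r (insert i (A \<union> B)) \<le> r (insert i A) + r B"
        using r[unfolded rank_function_def, THEN conjunct2, THEN conjunct2, rule_format, of "insert i A" B]
          B(1) by (simp add: Int_insert_left)
      moreover have "s (A \<inter> B) + s (insert i (A \<union> B)) \<le> s A + s (insert i B)"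
        using s[unfolded rank_function_def, THEN conjunct2, THEN conjunct2, rule_format, of A "insert i B"]
          A(1) by (simp add: Int_insert_right)
      moreover have "sum x (insert i (A \<union> B)) \<le> r (insert i (A \<union> B)) + s (insert i (A \<union> B))"
        "sum x (A \<inter> B) \<le> r (A \<inter> B) + s (A \<inter> B)"
        using x by (simp_all only: points_def mem_Collect_eq)
      moreover have "sum x (insert i (A \<union> B)) = x i + sum x (A \<union> B)" using A B by simp
      moreover have "sum x (A \<union> B) + sum x (A \<inter> B) = sum x A + sum x B"
        by (simp add: sum.union_inter)
      ultimately show ?thesis using A(2) B(2) i by linarith
    qed
  qed
qed

section \<open>Hindsight loads as the bases of one summed rank function\<close>

definition total_rank :: "'n::finite history \<Rightarrow> 'n set \<Rightarrow> nat" where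
  "total_rank h A = (\<Sum>(P, x)\<leftarrow>h. rank_fun P A)"

lemma total_rank_simps [simp]:
  "total_rank [] A = 0"
  "total_rank (h @ [(P, x)]) A = total_rank h A + rank_fun P A"
  by (simp_all add: total_rank_def)

lemma total_rank_UNIV: "total_rank h UNIV = presented h"
  by (simp add: total_rank_def presented_def Rank_def)

lemma rank_function_total_rank: "rank_function (total_rank h)"
proof (induction h rule: rev_induct)
  case Nil
  then show ?case by (simp add: rank_function_def)
next
  case (snoc px h)
  have "total_rank (h @ [px]) = (\<lambda>A. total_rank h A + rank_fun (fst px) A)"
    by (cases px) (simp add: fun_eq_iff)
  then show ?case
    using rank_function_add[OF snoc rank_function_rank_fun[of "fst px"]] by simp
qed

lemma total_rank_decompose:
  "x \<in> points (total_rank h) \<Longrightarrow>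
    \<exists>z. (\<forall>t<length h. z t \<in> vectors (fst (h ! t))) \<and> x = (\<lambda>i. \<Sum>t<length h. z t i)"
proof (induction h arbitrary: x rule: rev_induct)
  case Nil
  have "x i = 0" for i
  proof -
    have "sum x {i} \<le> 0" using Nil by (simp only: points_def total_rank_simps mem_Collect_eq)
    then show ?thesis by simp
  qed
  then show ?case by auto
next
  case (snoc px h)
  obtain P y where px: "px = (P, y)" by (cases px)
  have "x \<in> points (\<lambda>A. total_rank h A + rank_fun P A)"
    using snoc.prems by (simp add: px points_def)
  then obtain u v where u: "u \<in> points (total_rank h)" and v: "v \<in> points (rank_fun P)"
    and x: "x = (\<lambda>i. u i + v i)"
    using points_add_decompose[OF rank_function_total_rank rank_function_rank_fun] by blast
  from snoc.IH[OF u] obtain z where z: "\<forall>t<length h. z t \<in> vectors (fst (h ! t))"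
    "u = (\<lambda>i. \<Sum>t<length h. z t i)" by blast
  let ?z = "z(length h := v)"
  have "\<forall>t<length (h @ [px]). ?z t \<in> vectors (fst ((h @ [px]) ! t))"
    using z(1) v by (auto simp: px nth_append less_Suc_eq vectors_eq_points)
  moreover have "x = (\<lambda>i. \<Sum>t<length (h @ [px]). ?z t i)"
    by (simp add: x z(2) lessThan_Suc add.commute)
  ultimately show ?case by blast
qed

lemma total_rank_nth: "total_rank h A = (\<Sum>t<length h. rank_fun (fst (h ! t)) A)"
  by (simp add: total_rank_def sum_list_sum_nth case_prod_unfold lessThan_atLeast0)

lemma hindsight_eq_bases:
  "hindsight h = {x \<in> points (total_rank h). sum x UNIV = presented h}"
proof (intro equalityI subsetI)
  fix x assume "x \<in> hindsight h"
  then obtain z where z: "\<forall>t<length h. z t \<in> bases (fst (h ! t))"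
    and x: "x = (\<lambda>i. \<Sum>t<length h. z t i)" by (auto simp: hindsight_def)
  have sum: "sum x A = (\<Sum>t<length h. sum (z t) A)" for A
    unfolding x by (rule sum.swap)
  have "sum x A \<le> total_rank h A" for A
    unfolding sum total_rank_nth
    using z by (intro sum_mono) (auto simp: bases_def vectors_def)
  moreover have "sum x UNIV = presented h"
    unfolding sum total_rank_UNIV[symmetric] total_rank_nth
    using z by (intro sum.cong) (auto simp: bases_def Rank_def)
  ultimately show "x \<in> {x \<in> points (total_rank h). sum x UNIV = presented h}"
    by (simp add: points_def)
next
  fix x assume "x \<in> {x \<in> points (total_rank h). sum x UNIV = presented h}"
  then have x: "x \<in> points (total_rank h)" and eq: "sum x UNIV = presented h" by auto
  obtain z where z: "\<forall>t<length h. z t \<in> vectors (fst (h ! t))"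
    and xz: "x = (\<lambda>i. \<Sum>t<length h. z t i)"
    using total_rank_decompose[OF x] by blast
  have le: "sum (z t) UNIV \<le> rank_fun (fst (h ! t)) UNIV" if "t < length h" for t
    using z that by (simp add: vectors_def)
  \<comment> \<open>Every part is bounded by the rank of its round and the totals agree, so every
    part attains its rank and is a basis.\<close>
  have "(\<Sum>t<length h. sum (z t) UNIV) = (\<Sum>t<length h. rank_fun (fst (h ! t)) UNIV)"
    using eq sum.swap[of "\<lambda>i t. z t i" "{..<length h}" UNIV]
    by (simp add: total_rank_UNIV[symmetric] total_rank_nth xz)
  then have "sum (z t) UNIV = rank_fun (fst (h ! t)) UNIV" if "t < length h" for t
    using sum_mono_inv[of "\<lambda>t. sum (z t) UNIV" "{..<length h}" "\<lambda>t. rank_fun (fst (h ! t)) UNIV" t] le that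
    by blast
  then have "\<forall>t<length h. z t \<in> bases (fst (h ! t))"
    using z by (simp add: bases_def Rank_def)
  with xz show "x \<in> hindsight h" by (auto simp: hindsight_def)
qed

text \<open>Justifies the choice in \<open>OPT\<close>: a basis of \<open>total_rank h\<close> with
  the largest sum at every cap is majorized by all hindsight loads.\<close>

lemma OPT_least: "OPT h \<in> hindsight h" "l \<in> hindsight h \<Longrightarrow> OPT h \<preceq> l"
proof -
  obtain b where "b \<in> points (total_rank h)" "sum b UNIV = total_rank h UNIV"
    "\<And>z c. z \<in> points (total_rank h) \<Longrightarrow> capped_sum z c \<le> capped_sum b c"
    using exists_capped_sum_max[OF rank_function_total_rank] by metis
  then have "b \<in> hindsight h \<and> (\<forall>l\<in>hindsight h. b \<preceq> l)"
    by (simp add: hindsight_eq_bases majorizes_iff_capped_sum total_rank_UNIV)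
  then have "OPT h \<in> hindsight h \<and> (\<forall>l\<in>hindsight h. OPT h \<preceq> l)"
    unfolding OPT_def
    by (rule someI[where P = "\<lambda>l. l \<in> hindsight h \<and> (\<forall>l'\<in>hindsight h. l \<preceq> l')"])
  then show "OPT h \<in> hindsight h" "l \<in> hindsight h \<Longrightarrow> OPT h \<preceq> l" by auto
qed


section \<open>Plays\<close>

text \<open>The reachable histories without the stopping rule, so that invariants can be proved by
  induction on rounds independently of m.\<close>

inductive consistent :: "'n::finite allocation \<Rightarrow> 'n adversary \<Rightarrow> 'n history \<Rightarrow> bool" for A P where
  start: "consistent A P []"
| round: "consistent A P h \<Longrightarrow> x \<in> set_pmf (A h (P h)) \<Longrightarrow> consistent A P (h @ [(P h, x)])"

lemma load_simps [simp]: "load [] i = 0" "load (h @ [(P, x)]) i = load h i + x i"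
  by (simp_all add: load_def)

lemma presented_simps [simp]: "presented [] = 0" "presented (h @ [(P, x)]) = presented h + Rank P"
  by (simp_all add: presented_def)

lemma play_consistent:
  "h \<in> set_pmf (play A P m t) \<Longrightarrow> consistent A P h \<and> (length h = t \<or> presented h = m)"
proof (induction t arbitrary: h)
  case (Suc t)
  then obtain g where "g \<in> set_pmf (play A P m t)"
    and "h \<in> set_pmf (if presented g = m then return_pmf g
      else map_pmf (\<lambda>x. g @ [(P g, x)]) (A g (P g)))" by auto
  with Suc.IH[of g] show ?case by (auto intro: consistent.round split: if_splits)
qed (simp add: consistent.start)

lemma outcome_ended:
  assumes "P \<in> adversaries m" "allocation_strategy A" "h \<in> set_pmf (outcome A P m)"
  shows "consistent A P h" "presented h = m"
proof -
  have "\<exists>T. ended_by A P m T" using assms by (simp add: adversaries_def)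
  then have "ended_by A P m (LEAST T. ended_by A P m T)" by (rule LeastI_ex)
  then show "presented h = m" using assms(3) by (simp add: outcome_def ended_by_def)
  show "consistent A P h" using assms(3) play_consistent unfolding outcome_def by blast
qed

lemma play_deterministic: "\<exists>h. play (deterministic B) P m t = return_pmf h"
  by (induction t) (auto simp: bind_return_pmf deterministic_def)

lemma consistent_bases:
  "allocation_strategy A \<Longrightarrow> x \<in> set_pmf (A h P) \<Longrightarrow> x \<in> bases P"
  by (auto simp: allocation_strategy_def)

lemma sum_load_eq_presented:
  assumes "allocation_strategy A" "consistent A P h"
  shows "sum (load h) UNIV = presented h"
  using assms(2)
proof induction
  case (round h x)
  then show ?case using consistent_bases[OF assms(1)]
    by (simp add: sum.distrib bases_def)
qed simp


section \<open>Brick-Laying\<close>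

lemma brick_laying_step:
  assumes x: "x \<in> bases P" and z: "z \<in> vectors P"
    and opt: "\<And>y. y \<in> bases P \<Longrightarrow> (\<lambda>i. l i + x i) \<preceq> (\<lambda>i. l i + y i)"
  shows "sum z {i. l i + x i < c} + capped_sum l c \<le> capped_sum (\<lambda>i. l i + x i) c"
proof -
  define A where "A = {i. l i + x i < c}"
  \<comment> \<open>\<open>w i\<close> is the room of agent i below the cap, 0 if there is none. The
    sum of \<open>v\<close> is the gain of Brick-Laying under the cap; \<open>u\<close> is
    \<open>z\<close> restricted to the agents that stay strictly below it.\<close>
  define w where "w i = c - l i" for i
  define v where "v i = min (x i) (w i)" for i
  define u where "u i = (if i \<in> A then z i else 0)" for i
  have cap: "capped_sum (\<lambda>i. l i + y i) c = capped_sum l c + (\<Sum>i\<in>UNIV. min (y i) (w i))" for y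
    unfolding capped_sum_def sum.distrib[symmetric] w_def by (intro sum.cong) auto
  have r: "rank_function (rank_fun P)" by (rule rank_function_rank_fun)
  have xP: "x \<in> points (rank_fun P)" and zP: "z \<in> points (rank_fun P)"
    using x z by (auto simp: bases_def vectors_eq_points)
  have vP: "v \<in> points (rank_fun P)" using xP by (rule points_downward) (simp add: v_def)
  have uP: "u \<in> points (rank_fun P)" using zP by (rule points_downward) (simp add: u_def)
  have "sum u UNIV \<le> sum v UNIV"
  proof (rule ccontr)
    \<comment> \<open>Otherwise some unit vector in \<open>A\<close> extends \<open>v\<close>, and completing the result to a basis
      beats \<open>x\<close> at the cap \<open>c\<close>.\<close>
    assume "\<not> ?thesis"
    then have "sum v UNIV < sum u UNIV" by simp
    then obtain i where i: "v i < u i" and v': "v(i := Suc (v i)) \<in> points (rank_fun P)"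
      by (rule augment[OF r vP uP])
    have iA: "l i + x i < c" using i by (auto simp: u_def A_def split: if_splits)
    obtain y where y: "y \<in> points (rank_fun P)" "\<And>j. (v(i := Suc (v i))) j \<le> y j"
      "sum x UNIV \<le> sum y UNIV"
      using extend[OF r v' xP] by metis
    have "sum y UNIV \<le> rank_fun P UNIV" using y(1) by (simp add: points_def)
    then have "y \<in> bases P"
      using x y by (simp add: bases_def vectors_eq_points Rank_def)
    then have "capped_sum (\<lambda>i. l i + y i) c \<le> capped_sum (\<lambda>i. l i + x i) c"
      using opt by (simp add: majorizes_iff_capped_sum)
    then have le: "(\<Sum>j\<in>UNIV. min (y j) (w j)) \<le> sum v UNIV"
      by (simp add: cap v_def)
    \<comment> \<open>Agent i ends strictly below c, so the additional unit still fits under the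
      cap.\<close>
    have "(v(i := Suc (v i))) j \<le> min (y j) (w j)" for j
      using y(2)[of j] iA by (cases "j = i") (auto simp: v_def w_def)
    then have "sum (v(i := Suc (v i))) UNIV \<le> (\<Sum>j\<in>UNIV. min (y j) (w j))"
      by (intro sum_mono)
    with le show False unfolding sum_increment by simp
  qed
  moreover have "sum u UNIV = sum z A"
    by (simp add: u_def sum.If_cases)
  ultimately show ?thesis
    unfolding cap by (simp add: A_def v_def)
qed

lemma brick_laying_hindsight:
  assumes BL: "brick_laying BL" and h: "consistent (deterministic BL) P h"
    and "y \<in> hindsight h"
  shows "sum y {i. load h i < c} \<le> capped_sum (load h) c"
  using h assms(3)
proof (induction arbitrary: y)
  case start
  then show ?case by (simp add: hindsight_def)
next
  case (round h x)
  have x: "x = BL h (P h)" using round.hyps by (simp add: deterministic_def)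
  obtain z where z: "\<And>t. t < length (h @ [(P h, x)]) \<Longrightarrow> z t \<in> bases (fst ((h @ [(P h, x)]) ! t))"
    and y: "y = (\<lambda>i. \<Sum>t<length (h @ [(P h, x)]). z t i)"
    using round.prems by (auto simp: hindsight_def)
  define y' where "y' = (\<lambda>i. \<Sum>t<length h. z t i)"
  have "z t \<in> bases (fst (h ! t))" if "t < length h" for t
    using z[of t] that by (simp add: nth_append)
  then have y': "y' \<in> hindsight h" unfolding hindsight_def y'_def by blast
  have zP: "z (length h) \<in> vectors (P h)" using z[of "length h"] by (simp add: bases_def)
  have yy: "y = (\<lambda>i. y' i + z (length h) i)" by (simp add: y y'_def)
  let ?A = "{i. load h i + x i < c}"
  \<comment> \<open>Loads only grow, so the set of agents below c shrinks and the earlier bound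
    still applies.\<close>
  have "sum y' ?A \<le> sum y' {i. load h i < c}" by (intro sum_mono2) auto
  also have "\<dots> \<le> capped_sum (load h) c" by (rule round.IH[OF y'])
  finally have "sum y ?A \<le> capped_sum (load h) c + sum (z (length h)) ?A"
    by (simp add: yy sum.distrib)
  also have "\<dots> \<le> capped_sum (\<lambda>i. load h i + x i) c"
    using brick_laying_step[of x "P h" "z (length h)" "load h" c] BL zP
    by (simp add: x brick_laying_def)
  finally show ?case by (simp add: capped_sum_def)
qed


section \<open>The nested adversary\<close>

definition heaviest :: "nat \<Rightarrow> 'a set \<Rightarrow> ('a \<Rightarrow> nat) \<Rightarrow> 'a set" where
  "heaviest k S f = (SOME T. T \<subseteq> S \<and> card T = k \<and> (\<forall>i\<in>T. \<forall>j\<in>S - T. f j \<le> f i))"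

lemma heaviest:
  assumes "finite S" "k \<le> card S"
  shows "heaviest k S f \<subseteq> S" "card (heaviest k S f) = k"
    "\<And>i j. i \<in> heaviest k S f \<Longrightarrow> j \<in> S - heaviest k S f \<Longrightarrow> f j \<le> f i"
proof -
  let ?Q = "\<lambda>k T. T \<subseteq> S \<and> card T = k \<and> (\<forall>i\<in>T. \<forall>j\<in>S - T. f j \<le> f i)"
  have "\<exists>T. ?Q k T" using assms(2)
  proof (induction k)
    case 0
    show ?case by (intro exI[of _ "{}"]) simp
  next
    case (Suc k)
    then obtain T where T: "?Q k T" by auto
    have fin: "finite (S - T)" "finite T" using assms(1) T finite_subset by auto
    have "S - T \<noteq> {}"
      using Suc.prems T fin card_mono[of T S] by auto
    then have "Max (f ` (S - T)) \<in> f ` (S - T)" using fin by (intro Max_in) auto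
    then obtain j where j: "j \<in> S - T" "f j = Max (f ` (S - T))" by auto
    then have "f i \<le> f j" if "i \<in> S - T" for i using that fin by simp
    then have "?Q (Suc k) (insert j T)" using T j(1) fin by auto
    then show ?case by blast
  qed
  then have "?Q k (heaviest k S f)" unfolding heaviest_def by (rule someI_ex)
  then show "heaviest k S f \<subseteq> S" "card (heaviest k S f) = k"
    "\<And>i j. i \<in> heaviest k S f \<Longrightarrow> j \<in> S - heaviest k S f \<Longrightarrow> f j \<le> f i" by auto
qed

text \<open>Integrality is essential: either every chosen member has at least t + 1, or one has at
  most t. In the latter case so do all discarded members, and discarding them removes at most t
  each, leaving at least \<open>t * k + k\<close>.\<close>

lemma sum_heaviest_ge:
  assumes S: "finite S" "k \<le> card S" and sum: "t * card S + k \<le> sum f S"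
  shows "Suc t * k \<le> sum f (heaviest k S f)"
proof -
  let ?T = "heaviest k S f"
  note T = heaviest[OF S, where f = f]
  have fin: "finite ?T" using T(1) S(1) by (rule finite_subset)
  show ?thesis
  proof (cases "\<forall>i\<in>?T. Suc t \<le> f i")
    case True
    then have "(\<Sum>i\<in>?T. Suc t) \<le> sum f ?T" by (intro sum_mono) auto
    then show ?thesis using T(2) by (simp add: mult.commute)
  next
    case False
    then obtain i where "i \<in> ?T" "f i \<le> t" by (auto simp: not_le)
    then have "f j \<le> t" if "j \<in> S - ?T" for j using T(3)[OF _ that] by (meson order_trans)
    then have "sum f (S - ?T) \<le> (\<Sum>j\<in>S - ?T. t)" by (intro sum_mono)
    also have "\<dots> = t * (card S - k)"
      using T fin by (simp add: card_Diff_subset mult.commute)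
    finally have "sum f (S - ?T) \<le> t * (card S - k)" .
    moreover have "sum f S = sum f (S - ?T) + sum f ?T"
      using T(1) S(1) by (simp add: sum.subset_diff)
    moreover have "t * card S = t * (card S - k) + t * k"
      using S(2) by (simp flip: add_mult_distrib2)
    ultimately show ?thesis using sum by simp
  qed
qed

section \<open>The polymatroids offered by the nested adversary\<close>

definition free_polymatroid :: "'n set \<Rightarrow> nat \<Rightarrow> 'n polymatroid" where
  "free_polymatroid S k = Abs_polymatroid (\<lambda>A. if A \<inter> S = {} then 0 else k)"

lemma rank_fun_free_polymatroid:
  "rank_fun (free_polymatroid S k) = (\<lambda>A. if A \<inter> S = {} then 0 else k)"
  unfolding free_polymatroid_def by (rule Abs_polymatroid_inverse) auto

lemma bases_free_polymatroid:
  fixes S :: "'n::finite set"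
  assumes "x \<in> bases (free_polymatroid S k)"
  shows "i \<notin> S \<Longrightarrow> x i = 0"
proof -
  assume "i \<notin> S"
  moreover have "sum x {i} \<le> rank_fun (free_polymatroid S k) {i}"
    using assms by (simp only: bases_def vectors_def mem_Collect_eq)
  ultimately show ?thesis by (simp add: rank_fun_free_polymatroid)
qed

text \<open>For empty S the rank is 0, and there \<open>k \<le> card S\<close> forces k = 0.\<close>

lemma Rank_free_polymatroid:
  fixes S :: "'n::finite set"
  assumes "k \<le> card S"
  shows "Rank (free_polymatroid S k) = k"
  using assms by (auto simp: Rank_def rank_fun_free_polymatroid)

text \<open>The \<open>N c\<close> of the overview; \<open>level l 0\<close> counts all agents,
  matching the initial active set.\<close>

definition level :: "('n::finite \<Rightarrow> nat) \<Rightarrow> nat \<Rightarrow> nat" where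
  "level l c = card {i. c \<le> l i}"

text \<open>The sets \<open>S c\<close> of the overview. \<open>active l h t\<close> reads only the
  first t rounds of h, so it is already known when round t (counted from 0) is played and does not
  change later.\<close>

fun active :: "('n::finite \<Rightarrow> nat) \<Rightarrow> 'n history \<Rightarrow> nat \<Rightarrow> 'n set" where
  "active l h 0 = UNIV"
| "active l h (Suc t) = heaviest (level l (Suc t)) (active l h t) (load (take (Suc t) h))"

text \<open>The bricks that \<open>l\<close> lays at height \<open>t + 1\<close> are offered in round \<open>t\<close>, to as many agents as
  \<open>l\<close> lifts to height \<open>t\<close>.\<close>

definition nested_adversary :: "('n::finite \<Rightarrow> nat) \<Rightarrow> 'n adversary" where
  "nested_adversary l h = free_polymatroid (active l h (length h)) (level l (Suc (length h)))"

lemma level_Suc_le: "level l (Suc c) \<le> level l c"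
  unfolding level_def by (intro card_mono) auto

lemma card_active: "card (active l h t) = level l t"
proof (induction t)
  case 0
  then show ?case by (simp add: level_def)
next
  case (Suc t)
  then show ?case using level_Suc_le[of l t] by (simp add: heaviest(2))
qed

lemma active_Suc_subset: "active l h (Suc t) \<subseteq> active l h t"
  using heaviest(1)[of "active l h t"] level_Suc_le[of l t] by (simp add: card_active)

lemma active_antimono: "s \<le> t \<Longrightarrow> active l h t \<subseteq> active l h s"
  by (rule lift_Suc_antimono_le[of "active l h"]) (rule active_Suc_subset)

lemma active_append: "t \<le> length h \<Longrightarrow> active l (h @ h') t = active l h t"
  by (induction t) auto

lemma Rank_nested_adversary: "Rank (nested_adversary l h) = level l (Suc (length h))"
  unfolding nested_adversary_def
  by (rule Rank_free_polymatroid) (simp add: card_active level_Suc_le)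

section \<open>Loads and ranks in plays against the nested adversary\<close>

lemma presented_nested_adversary:
  "consistent A (nested_adversary l) h \<Longrightarrow> presented h = capped_sum l (length h)"
  by (induction rule: consistent.induct)
    (simp_all add: capped_sum_0 capped_sum_Suc Rank_nested_adversary level_def)

text \<open>For a fixed c the left side is frozen once c rounds are over, since dropped agents are
  never served again. A new c arises only when the active set shrinks, where
  \<open>sum_heaviest_ge\<close> bounds what the survivors carry.\<close>

lemma sum_inactive_load:
  assumes A: "allocation_strategy A" and "consistent A (nested_adversary l) h" "c \<le> length h"
  shows "sum (load h) (- active l h c) + c * level l c \<le> capped_sum l c"
  using assms(2,3)
proof (induction arbitrary: c)
  case start
  then show ?case by simp
next
  case (round h x)
  let ?n = "length h" and ?h = "h @ [(nested_adversary l h, x)]"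
  have x0: "x i = 0" if "i \<notin> active l h ?n" for i
    using consistent_bases[OF A round.hyps(2)] that
    unfolding nested_adversary_def by (rule bases_free_polymatroid)
  have same: "sum (load ?h) (- active l ?h c) = sum (load h) (- active l h c)" if "c \<le> ?n" for c
  proof -
    have "active l ?h c = active l h c" using that by (rule active_append)
    moreover have "x i = 0" if "i \<in> - active l h c" for i
      using x0 active_antimono[OF \<open>c \<le> ?n\<close>] that by blast
    ultimately show ?thesis by (auto intro: sum.cong)
  qed
  show ?case
  proof (cases "c \<le> ?n")
    case True
    then show ?thesis using round.IH[OF True] same[OF True] by simp
  next
    case False
    with round.prems have c: "c = Suc ?n" by simp
    let ?S = "active l ?h ?n"
    have h': "consistent A (nested_adversary l) ?h" using round.hyps by (rule consistent.round)
    have total: "sum (load ?h) UNIV = capped_sum l ?n + level l (Suc ?n)"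
      using sum_load_eq_presented[OF A h'] presented_nested_adversary[OF h']
      by (simp add: capped_sum_Suc level_def)
    have "sum (load ?h) (- ?S) + ?n * level l ?n \<le> capped_sum l ?n"
      using round.IH[OF order_refl] same[OF order_refl] by simp
    \<comment> \<open>The total is known, so the upper bound outside \<open>?S\<close> becomes a
      lower bound inside; the latest round supplies the summand
      \<open>level l (Suc ?n)\<close>.\<close>
    then have "?n * card ?S + level l (Suc ?n) \<le> sum (load ?h) ?S"
      using total sum_UNIV_split[of "load ?h" ?S] by (simp add: card_active)
    moreover have "level l (Suc ?n) \<le> card ?S" by (simp add: card_active level_Suc_le)
    ultimately have "Suc ?n * level l (Suc ?n) \<le> sum (load ?h) (active l ?h (Suc ?n))"
      using sum_heaviest_ge[of ?S "level l (Suc ?n)" ?n "load ?h"] by simp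
    then show ?thesis
      unfolding c using total sum_UNIV_split[of "load ?h" "active l ?h (Suc ?n)"]
        capped_sum_Suc[of l ?n]
      by (simp add: level_def)
  qed
qed

lemma capped_sum_load_nested_adversary:
  assumes A: "allocation_strategy A" and h: "consistent A (nested_adversary l) h"
  shows "capped_sum (load h) c \<le> capped_sum l c"
proof (cases "c \<le> length h")
  case True
  have "capped_sum (load h) c \<le> sum (load h) (- active l h c) + c * card (active l h c)"
    using capped_sum_le_cut[of "load h" c "- active l h c"] by simp
  then show ?thesis using sum_inactive_load[OF A h True] by (simp add: card_active)
next
  case False
  \<comment> \<open>Fewer than c rounds have been played, so even the uncapped total is small
    enough.\<close>
  have "capped_sum (load h) c \<le> capped_sum l (length h)"
    using capped_sum_le_sum[of "load h" c]
    by (simp add: sum_load_eq_presented[OF A h] presented_nested_adversary[OF h])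
  also have "\<dots> \<le> capped_sum l c" using False by (intro capped_sum_mono_cap) simp
  finally show ?thesis .
qed

text \<open>\<open>K\<close> counts the leading rounds whose active set meets \<open>D\<close>. Each
  of them adds its full rank, together \<open>capped_sum l K\<close>. If the count stops early, the
  active set of round \<open>K\<close> lies in \<open>- D\<close>.\<close>

lemma total_rank_nested_adversary:
  fixes D :: "'n::finite set"
  assumes "consistent A (nested_adversary l) h"
  shows "\<exists>K\<le>length h. capped_sum l K \<le> total_rank h D \<and>
    (K = length h \<or> level l K \<le> card (- D))"
  using assms
proof induction
  case start
  then show ?case by (simp add: capped_sum_0)
next
  case (round h x)
  then obtain K where K: "K \<le> length h" "capped_sum l K \<le> total_rank h D"
    "K = length h \<or> level l K \<le> card (- D)" by blast
  let ?S = "active l h (length h)"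
  show ?case
  proof (cases "K = length h \<and> D \<inter> ?S \<noteq> {}")
    case True
    then have "capped_sum l (Suc K) \<le> total_rank (h @ [(nested_adversary l h, x)]) D"
      using K(2) by (simp add: capped_sum_Suc level_def nested_adversary_def rank_fun_free_polymatroid)
    then show ?thesis using True by (intro exI[of _ "Suc K"]) simp
  next
    case False
    have "level l K \<le> card (- D)"
    proof (cases "K = length h")
      case True
      with False have "?S \<subseteq> - D" by blast
      then have "card ?S \<le> card (- D)" by (intro card_mono) auto
      then show ?thesis using True by (simp add: card_active)
    qed (use K in simp)
    then show ?thesis using K by (intro exI[of _ K]) simp
  qed
qed

lemma nested_adversary_in_adversaries: "nested_adversary l \<in> adversaries (sum l UNIV)"
proof -
  let ?m = "sum l UNIV"
  have "presented h = ?m" if "h \<in> set_pmf (play A (nested_adversary l) ?m ?m)" for A h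
  proof -
    from play_consistent[OF that] consider "presented h = ?m"
      | "consistent A (nested_adversary l) h" "length h = ?m" by blast
    then show ?thesis
    proof cases
      case 2
      \<comment> \<open>After \<open>?m\<close> rounds all levels up to \<open>?m\<close> have been
        offered, and no agent of \<open>l\<close> is higher.\<close>
      have "l i \<le> ?m" for i by (intro member_le_sum) auto
      then have "capped_sum l ?m = ?m" by (rule capped_sum_eq_sum)
      then show ?thesis using presented_nested_adversary[OF 2(1)] 2(2) by simp
    qed
  qed
  then show ?thesis unfolding adversaries_def ended_by_def by blast
qed

section \<open>Comparison of final loads and of hindsight optima\<close>

theorem theorem1:
  fixes BL :: "'n::finite history \<Rightarrow> 'n polymatroid \<Rightarrow> ('n \<Rightarrow> nat)"
    and A' :: "'n allocation"
    and P :: "'n adversary"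
    and m :: nat
  assumes "brick_laying BL"
    and "allocation_strategy A'"
    and "P \<in> adversaries m"
  shows "\<exists>P'\<in>adversaries m.
    AE (h, h') in measure_pmf (pair_pmf (outcome (deterministic BL) P m) (outcome A' P' m)).
      load h \<preceq> load h' \<and> OPT h \<succeq> OPT h'"
proof -
  have BL: "allocation_strategy (deterministic BL)"
    using assms(1) by (simp add: allocation_strategy_def deterministic_def brick_laying_def)
  \<comment> \<open>Brick-Laying and the adversary are both deterministic, so there is a single
    history and the new adversary can be built from its final load.\<close>
  obtain h where h_outcome: "outcome (deterministic BL) P m = return_pmf h"
    using play_deterministic unfolding outcome_def by blast
  then have h: "consistent (deterministic BL) P h" and hm: "presented h = m"
    using outcome_ended[OF assms(3) BL, of h] by simp_all
  define l where "l = load h"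
  have lm: "sum l UNIV = m" using sum_load_eq_presented[OF BL h] hm by (simp add: l_def)
  define y where "y = OPT h"
  have y: "y \<in> hindsight h" unfolding y_def by (rule OPT_least)
  then have ym: "sum y UNIV = m" using hm by (simp add: hindsight_eq_bases)
  have P': "nested_adversary l \<in> adversaries m"
    using nested_adversary_in_adversaries[of l] lm by simp
  have "l \<preceq> load h' \<and> y \<succeq> OPT h'" if "h' \<in> set_pmf (outcome A' (nested_adversary l) m)" for h'
  proof
    have h': "consistent A' (nested_adversary l) h'" and h'm: "presented h' = m"
      using outcome_ended[OF P' assms(2) that] by simp_all
    show "l \<preceq> load h'"
      unfolding majorizes_iff_capped_sum
      using capped_sum_load_nested_adversary[OF assms(2) h'] sum_load_eq_presented[OF assms(2) h']
        lm h'm by simp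
    have opt: "OPT h' \<in> hindsight h'" by (rule OPT_least)
    then have optP: "OPT h' \<in> points (total_rank h')" and optm: "sum (OPT h') UNIV = m"
      using h'm by (simp_all add: hindsight_eq_bases)
    have "capped_sum y c \<le> capped_sum (OPT h') c" for c
    proof -
      \<comment> \<open>By the min-max certificate it suffices to bound the capped sum of
        \<open>y\<close> by the rank expression of this one set \<open>D\<close>.\<close>
      obtain v D where v: "v \<in> points (total_rank h')" "\<And>i. v i \<le> c"
        and D: "total_rank h' D + c * card (- D) = sum v UNIV"
        using min_max_in_box[OF rank_function_total_rank] by metis
      obtain K where K: "K \<le> length h'" "capped_sum l K \<le> total_rank h' D"
        "K = length h' \<or> level l K \<le> card (- D)"
        using total_rank_nested_adversary[OF h'] by blast
      have "capped_sum y c \<le> total_rank h' D + c * card (- D)"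
      proof (cases "K = length h'")
        case True
        then have "m \<le> total_rank h' D" using K(2) presented_nested_adversary[OF h'] h'm by simp
        then show ?thesis using capped_sum_le_sum[of y c] ym by simp
      next
        case False
        \<comment> \<open>Cut \<open>y\<close> at height \<open>K\<close> of \<open>l\<close>: the
          agents below are paid for by \<open>total_rank h' D\<close>, and the others number at most
          \<open>card (- D)\<close>.\<close>
        have "- {i. l i < K} = {i. K \<le> l i}" by auto
        then have "capped_sum y c \<le> sum y {i. l i < K} + c * level l K"
          using capped_sum_le_cut[of y c "{i. l i < K}"] by (simp add: level_def)
        also have "\<dots> \<le> capped_sum l K + c * card (- D)"
          using brick_laying_hindsight[OF assms(1) h y, of K] K(3) False
          by (intro add_mono mult_le_mono2) (auto simp: l_def)
        finally show ?thesis using K(2) by simp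
      qed
      also have "\<dots> = capped_sum v c" using D v(2) by (simp add: capped_sum_eq_sum)
      also have "\<dots> \<le> capped_sum (OPT h') c"
      proof -
        \<comment> \<open>Completing \<open>v\<close> to the total m gives a feasible hindsight
          load, whose capped sum \<open>OPT h'\<close> cannot fall below.\<close>
        obtain w where w: "w \<in> points (total_rank h')" "\<And>i. v i \<le> w i"
          "sum (OPT h') UNIV \<le> sum w UNIV"
          using extend[OF rank_function_total_rank v(1) optP] by metis
        have "sum w UNIV \<le> m"
          using w(1) h'm total_rank_UNIV[of h'] by (auto simp: points_def dest: spec[of _ UNIV])
        then have "w \<in> hindsight h'"
          using w(1,3) optm h'm by (simp add: hindsight_eq_bases)
        then have "capped_sum w c \<le> capped_sum (OPT h') c"
          using OPT_least(2)[of w h'] by (simp add: majorizes_iff_capped_sum)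
        with capped_sum_mono[of v w c] w(2) show ?thesis by simp
      qed
      finally show ?thesis .
    qed
    then show "y \<succeq> OPT h'"
      unfolding majorizes_iff_capped_sum using ym optm by simp
  qed
  then have "AE (h, h') in measure_pmf
      (pair_pmf (outcome (deterministic BL) P m) (outcome A' (nested_adversary l) m)).
      load h \<preceq> load h' \<and> OPT h \<succeq> OPT h'"
    by (auto simp: AE_measure_pmf_iff h_outcome l_def y_def)
  with P' show ?thesis by blast
qed

end
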